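(* Let $\lambda\in(0,1]$ and $p\in(0,1]$, and let $f$ be meromorphic in $\mathbb{D}=\{z\in\mathbb{C}:|z|<1\}$ and such that $f(0)=f'(0)-1=0$. Suppose that $$\left|\frac{z}{f(z)}-z\left(\frac{z}{f(z)}\right)'-1\right|<\lambda\quad\text{for all } z\in\mathbb{D},$$ and that $f$, with Taylor expansion $$f(z)=z+\sum_{n=2}^{\infty}a_nz^n$$ around the origin, has no pole in the disk $\{z:|z|<p\}$. Then $$|a_2|\le\frac{1+\lambda p^2}{p}.$$ The inequality is sharp, and (among the functions $f$ meromorphic in $\mathbb{D}$ with $f(0)=f'(0)-1=0$ that satisfy $\left|\frac{z}{f(z)}-z\left(\frac{z}{f(z)}\right)'-1\right|<\lambda$ for all $z\in\mathbb{D}$ and have no pole in the disk $\{z:|z|<p\}$) equality is attained if and only if $$f(z)=\frac{z}{\left(1-\frac{e^{i\theta}z}{p}\right)\left(1-\lambda p e^{i\theta}z\right)}$$ for some $\theta\in[0,2\pi)$.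
   Context: The function $z/f(z)$ is understood as the meromorphic function on $\mathbb{D}$ obtained after removing removable singularities: it takes the value $1$ at $z=0$ and the value $0$ at poles of $f$. The prime denotes the derivative with respect to $z$. The hypothesis that the inequality holds for all $z\in\mathbb{D}$ includes that $z/f(z)$ is finite (holomorphic) at every point of $\mathbb{D}$. Sharp means that the bound is attained by some function satisfying the hypotheses for the given $\lambda$ and $p$. *)

theory Defs
  imports "HOL-Complex_Analysis.Complex_Analysis"
begin

(* remove_sings makes this 1 at 0 (where the raw quotient is 0/0) and 0 at the poles of f;
   a zero of f in the punctured disk remains a pole, with the junk value 0. *)
definition z_over :: "(complex \<Rightarrow> complex) \<Rightarrow> complex \<Rightarrow> complex" where
  "z_over f = remove_sings (\<lambda>z. z / f z)"

(* A meromorphic function on the disk is represented by its nicely meromorphic representative: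
   analytic off its poles, with value 0 at each pole, so that equality of meromorphic functions
   is pointwise equality on the disk.  The derivative condition entails that f is analytic at 0.
   Holomorphy of z_over f expresses that z / f(z) is finite at every point of the disk. *)
definition U_class :: "real \<Rightarrow> (complex \<Rightarrow> complex) set" where
  "U_class lam = {f. f nicely_meromorphic_on ball 0 1 \<and>
     f 0 = 0 \<and> (f has_field_derivative 1) (at 0) \<and>
     z_over f holomorphic_on ball 0 1 \<and>
     (\<forall>z\<in>ball 0 1. norm (z_over f z - z * deriv (z_over f) z - 1) < lam)}"

definition U_class_no_pole :: "real \<Rightarrow> real \<Rightarrow> (complex \<Rightarrow> complex) set" where
  "U_class_no_pole lam p = {f \<in> U_class lam. \<forall>z\<in>ball 0 p. \<not> is_pole f z}"

definition taylor_coeff :: "(complex \<Rightarrow> complex) \<Rightarrow> nat \<Rightarrow> complex" where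
  "taylor_coeff f n = fps_nth (fps_expansion f 0) n"

end

theory Submission
  imports Defs
begin

text \<open>
  Put \<open>g(z) = z/f(z)\<close>, so that \<open>g(0) = 1\<close> and \<open>g'(0) = -a\<^sub>2\<close>, and write
  \<open>g(z) = 1 + z h(z)\<close>. Since \<open>z\<^sup>2 h'(z) = -(g(z) - z g'(z) - 1)\<close>, the hypothesis says
  \<open>|z\<^sup>2 h'(z)| < \<lambda>\<close>, and the maximum principle improves this to \<open>|h'| \<le> \<lambda>\<close>. Hence
  \<open>k = h - h(0)\<close> is \<open>\<lambda>\<close>-Lipschitz, vanishes at the origin, and
  \<open>g(z) = 1 - a\<^sub>2 z + z k(z)\<close> (\<open>lipschitz_second_order_remainder\<close>).

  A zero of \<open>g\<close> in \<open>|z| < p\<close> would be a pole of \<open>f\<close>, and the zeros of \<open>g\<close> are the fixed points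
  of \<open>T(z) = (1 + z k(z)) / a\<^sub>2\<close>. If \<open>|a\<^sub>2| \<ge> (1 + \<lambda>p\<^sup>2)/p\<close>, then \<open>|z k(z)| \<le> \<lambda>|z|\<^sup>2\<close> shows
  that \<open>T\<close> maps the closed disk of radius \<open>p\<close> into itself, so by Brouwer's theorem \<open>T\<close> has a fixed
  point \<open>z\<^sub>0\<close> there. For \<open>p = 1\<close> this uses the continuous extension of the Lipschitz function \<open>k\<close> to
  the closed unit disk. Being no zero of \<open>g\<close> in the open disk, \<open>z\<^sub>0\<close> lies on \<open>|z| = p\<close>. So
  \<open>|a\<^sub>2| p = |1 + z\<^sub>0 k(z\<^sub>0)| \<le> 1 + \<lambda>p\<^sup>2\<close>: the bound holds, and in the case of equality
  \<open>z\<^sub>0 k(z\<^sub>0) = \<lambda>p\<^sup>2\<close>. The Lipschitz bound is then attained along the whole radius to \<open>z\<^sub>0\<close>, and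
  the equality case of Schwarz's lemma gives \<open>k(z) = \<lambda>u\<^sup>2 z\<close> with \<open>u = p/z\<^sub>0\<close>
  (\<open>zero_free_imp_extremal\<close>). Hence \<open>a\<^sub>2 = u(1/p + \<lambda>p)\<close> and
  \<open>g(z) = (1 - uz/p)(1 - \<lambda>puz)\<close>. Conversely, \<open>z/g(z)\<close> with this \<open>g\<close> lies in the class and
  has \<open>|a\<^sub>2| = 1/p + \<lambda>p\<close>.
\<close>

section \<open>The second-order remainder of a holomorphic function on the disk\<close>

text \<open>
  On the circle \<open>|w| = r\<close> the hypothesis reads \<open>|F(w)| \<le> M / r\<^sup>n\<close>. By the maximum principle this
  bound persists inside the circle, and \<open>r\<close> may tend to \<open>1\<close>.
\<close>
lemma norm_le_of_norm_power_mult_le: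
  fixes F :: "complex \<Rightarrow> complex"
  assumes hol: "F holomorphic_on ball 0 1"
    and bound: "\<And>z. z \<in> ball 0 1 \<Longrightarrow> norm (z ^ n * F z) \<le> M"
    and z: "z \<in> ball 0 1"
  shows "norm (F z) \<le> M"
proof -
  have on_disk: "norm (F z) \<le> M / r ^ n" if r: "norm z < r" "r < 1" for r
  proof (rule maximum_modulus_frontier[of F "cball 0 r"])
    have "r > 0" using r(1) norm_ge_zero[of z] by linarith
    have sub: "cball 0 r \<subseteq> ball (0::complex) 1" using r by auto
    show "F holomorphic_on interior (cball 0 r)"
      using hol sub interior_subset by (meson holomorphic_on_subset subset_trans)
    show "continuous_on (closure (cball 0 r)) F"
      using hol sub by (metis closed_cball closure_closed continuous_on_subset
          holomorphic_on_imp_continuous_on)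
    show "z \<in> cball 0 r" using r by simp
    fix w :: complex assume "w \<in> frontier (cball 0 r)"
    with \<open>r > 0\<close> have w: "norm w = r" by (simp add: frontier_cball)
    hence "r ^ n * norm (F w) \<le> M"
      using bound[of w] r by (simp add: norm_mult norm_power)
    thus "norm (F w) \<le> M / r ^ n" using \<open>r > 0\<close> by (simp add: field_simps)
  qed auto
  have "((\<lambda>r. M / r ^ n) \<longlongrightarrow> M / 1 ^ n) (at_left (1::real))"
    by (intro tendsto_intros) auto
  moreover have "eventually (\<lambda>r. norm (F z) \<le> M / r ^ n) (at_left (1::real))"
    using z on_disk by (auto simp: eventually_at_left_field intro!: exI[of _ "norm z"])
  ultimately show ?thesis
    by (auto intro: tendsto_lowerbound)
qed

text \<open>
  The expression \<open>g - z g' - 1\<close> kills the constant and the linear term of \<open>g\<close>; up to sign it is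
  \<open>z\<^sup>2\<close> times the derivative of the difference quotient \<open>(g - 1)/z\<close>. Bounding it therefore bounds
  that derivative, and \<open>k\<close> is the difference quotient shifted to vanish at the origin.
\<close>
lemma lipschitz_second_order_remainder:
  fixes g :: "complex \<Rightarrow> complex"
  assumes g: "g holomorphic_on ball 0 1" "g 0 = 1"
    and bound: "\<And>z. z \<in> ball 0 1 \<Longrightarrow> norm (g z - z * deriv g z - 1) < lam"
  obtains k where "k holomorphic_on ball 0 1" "k 0 = 0" "lam-lipschitz_on (ball 0 1) k"
    "\<And>z. z \<in> ball 0 1 \<Longrightarrow> g z = 1 + deriv g 0 * z + z * k z"
proof -
  define h where "h z = (if z = 0 then deriv g 0 else (g z - 1) / z)" for z
  have h: "h holomorphic_on ball 0 1"
  proof (rule pole_theorem_open_0[where g = "\<lambda>z. g z - 1" and a = 0])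
    show "(\<lambda>z. g z - 1) holomorphic_on ball 0 1"
      using g by (intro holomorphic_intros)
    have "(g has_field_derivative deriv g 0) (at 0)"
      using g(1) by (rule holomorphic_derivI) auto
    hence "deriv (\<lambda>z. g z - 1) 0 = deriv g 0"
      by (intro DERIV_imp_deriv) (auto intro!: derivative_eq_intros)
    thus "h 0 = deriv (\<lambda>z. g z - 1) 0" by (simp add: h_def)
  qed (simp_all add: h_def g)
  have gh: "g z = 1 + z * h z" for z
    using g by (simp add: h_def)
  have lam: "lam > 0"
    using bound[of 0] g by simp
  have "norm (deriv h z) \<le> lam" if z: "z \<in> ball 0 1" for z
  proof (rule norm_le_of_norm_power_mult_le[of "deriv h" 2])
    show "deriv h holomorphic_on ball 0 1" using h by (intro holomorphic_deriv) auto
    fix w :: complex assume w: "w \<in> ball 0 1"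
    have "(h has_field_derivative deriv h w) (at w)"
      using h w by (intro holomorphic_derivI[of _ "ball 0 1"]) auto
    hence "((\<lambda>z. 1 + z * h z) has_field_derivative h w + w * deriv h w) (at w)"
      by (auto intro!: derivative_eq_intros)
    hence "deriv g w = h w + w * deriv h w"
      unfolding gh[symmetric] by (rule DERIV_imp_deriv)
    hence "w\<^sup>2 * deriv h w = - (g w - w * deriv g w - 1)"
      by (simp add: gh[of w] algebra_simps power2_eq_square)
    thus "norm (w\<^sup>2 * deriv h w) \<le> lam"
      using bound[OF w] by (simp only: norm_minus_cancel)
  qed (use z in auto)
  hence "norm (h x - h y) \<le> lam * norm (x - y)" if "x \<in> ball 0 1" "y \<in> ball 0 1" for x y
    using that
    by (intro field_differentiable_bound[OF convex_ball holomorphic_derivI[OF h open_ball]])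
  hence "lam-lipschitz_on (ball 0 1) (\<lambda>z. h z - h 0)"
    using lam by (intro lipschitz_onI) (auto simp: dist_norm)
  moreover have "g z = 1 + deriv g 0 * z + z * (h z - h 0)" for z
    using gh[of z] by (simp add: h_def algebra_simps)
  moreover have "(\<lambda>z. h z - h 0) holomorphic_on ball 0 1"
    using h by (intro holomorphic_intros)
  ultimately show ?thesis
    using that[of "\<lambda>z. h z - h 0"] by simp
qed

section \<open>Zero-free functions with a large linear coefficient\<close>

text \<open>The equality case of the triangle inequality \<open>|1 + w| \<le> 1 + |w|\<close>.\<close>
lemma norm_one_plus_extremal:
  fixes w :: complex
  assumes "norm w \<le> s" "1 + s \<le> norm (1 + w)"
  shows "w = of_real s"
proof -
  have "s \<ge> 0" using assms(1) norm_ge_zero order_trans by blast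
  have 1: "(norm (1 + w))\<^sup>2 = 1 + 2 * Re w + (norm w)\<^sup>2"
    by (simp only: cmod_power2) (simp add: power2_eq_square algebra_simps)
  have "(1 + s)\<^sup>2 \<le> (norm (1 + w))\<^sup>2"
    using assms(2) \<open>s \<ge> 0\<close> by (intro power_mono) auto
  moreover have "(norm w)\<^sup>2 \<le> s\<^sup>2"
    using assms(1) by (intro power_mono) auto
  ultimately have "s \<le> Re w"
    using 1 by (simp add: power2_eq_square algebra_simps)
  moreover from this have "(Re w)\<^sup>2 \<ge> s\<^sup>2"
    using \<open>s \<ge> 0\<close> by (intro power_mono) auto
  ultimately have "Re w = s" and "(Im w)\<^sup>2 \<le> 0"
    using \<open>(norm w)\<^sup>2 \<le> s\<^sup>2\<close> complex_Re_le_cmod[of w] assms(1)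
    unfolding cmod_power2 by linarith+
  hence "Re w = s" "Im w = 0" by auto
  thus ?thesis by (simp add: complex_eq_iff)
qed

text \<open>
  The zeros of \<open>1 - b z + z k(z)\<close> are the fixed points of \<open>z \<mapsto> (1 + z k(z)) / b\<close>, which maps the closed
  disk of radius \<open>p\<close> into itself when \<open>b\<close> is large. A Brouwer fixed point can then only lie on the
  boundary circle, where every estimate used must be an equality.
\<close>
lemma zero_free_imp_extremal:
  fixes k :: "complex \<Rightarrow> complex"
  assumes "0 < lam" "0 < p" "p \<le> 1"
    and hol: "k holomorphic_on ball 0 1" and k0: "k 0 = 0"
    and lip: "lam-lipschitz_on (ball 0 1) k"
    and nz: "\<And>z. norm z < p \<Longrightarrow> 1 - b * z + z * k z \<noteq> 0"
    and large: "(1 + lam * p\<^sup>2) / p \<le> norm b"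
  obtains u where "norm u = 1" "b = u * of_real ((1 + lam * p\<^sup>2) / p)"
    "\<And>z. z \<in> ball 0 1 \<Longrightarrow> k z = of_real lam * u\<^sup>2 * z"
proof -
  obtain K where K: "lam-lipschitz_on (cball 0 1) K" "\<And>z. z \<in> ball 0 1 \<Longrightarrow> K z = k z"
    using lipschitz_extend_closure[OF lip] by (auto simp: closure_ball)
  have contK: "continuous_on (cball 0 1) K"
    using K(1) by (rule lipschitz_on_continuous_on)
  have K0: "K 0 = 0" using K(2)[of 0] k0 by simp
  have dK: "norm (K x - K y) \<le> lam * norm (x - y)" if "norm x \<le> 1" "norm y \<le> 1" for x y
    using lipschitz_onD[OF K(1), of x y] that by (simp add: dist_norm)
  have nK: "norm (K x) \<le> lam * norm x" if "norm x \<le> 1" for x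
    using dK[of x 0] that K0 by simp
  have bpos: "norm b > 0"
    using large assms by (smt (verit) divide_pos_pos mult_nonneg_nonneg zero_le_power2)
  have bp: "1 + lam * p\<^sup>2 \<le> norm b * p"
    using large \<open>0 < p\<close> by (simp add: field_simps)
  have zK: "norm (x * K x) \<le> lam * p\<^sup>2" if "norm x \<le> p" for x
  proof -
    have "norm x * norm (K x) \<le> p * (lam * p)"
      using nK[of x] that assms
      by (intro mult_mono) (auto intro: order_trans[OF _ mult_left_mono[of "norm x" p lam]])
    thus ?thesis by (simp add: norm_mult power2_eq_square mult_ac)
  qed
  obtain z0 where z0: "z0 \<in> cball 0 p" "(1 + z0 * K z0) / b = z0"
  proof (rule brouwer_ball[of p 0 "\<lambda>z. (1 + z * K z) / b"])
    show "continuous_on (cball 0 p) (\<lambda>z. (1 + z * K z) / b)"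
      using bpos contK assms by (intro continuous_intros continuous_on_subset[OF contK]) auto
    show "(\<lambda>z. (1 + z * K z) / b) \<in> cball 0 p \<rightarrow> cball 0 p"
    proof
      fix z :: complex assume "z \<in> cball 0 p"
      hence "norm (1 + z * K z) \<le> norm b * p"
        using zK[of z] bp norm_triangle_ineq[of 1 "z * K z"] by simp
      thus "(1 + z * K z) / b \<in> cball 0 p"
        using bpos by (simp add: norm_divide field_simps)
    qed
  qed (use assms in auto)
  have fix_eq: "b * z0 = 1 + z0 * K z0"
    using z0(2) bpos by (auto simp: field_simps)
  have nz0: "norm z0 = p"
  proof (rule ccontr)
    assume "norm z0 \<noteq> p"
    hence "norm z0 < p" using z0(1) by simp
    moreover from this have "K z0 = k z0" using K(2)[of z0] assms by simp
    ultimately show False using nz[of z0] fix_eq by simp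
  qed
  have "z0 \<noteq> 0" using nz0 assms by auto
  have w: "z0 * K z0 = of_real (lam * p\<^sup>2)"
  proof (rule norm_one_plus_extremal)
    show "norm (z0 * K z0) \<le> lam * p\<^sup>2" using zK nz0 by simp
    show "1 + lam * p\<^sup>2 \<le> norm (1 + z0 * K z0)"
      using bp nz0 by (simp flip: fix_eq add: norm_mult)
  qed
  have "norm (z0 * K z0) = lam * p\<^sup>2"
    unfolding w using assms by (simp del: of_real_mult of_real_power)
  hence nKz0: "norm (K z0) = lam * p"
    using nz0 assms by (simp add: norm_mult power2_eq_square)
  \<comment> \<open>From the origin to \<open>z0\<close> the values of \<open>K\<close> move by \<open>lam * norm z0\<close>, the most that the Lipschitz
      constant permits, so \<open>norm (K z) = lam * norm z\<close> on the whole segment. Its midpoint lies in the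
      open disk even when \<open>p = 1\<close>, so Schwarz's lemma applies there.\<close>
  obtain \<alpha> where \<alpha>: "\<And>z. norm z < 1 \<Longrightarrow> k z / of_real lam = \<alpha> * z"
  proof -
    have half: "norm (z0 / 2) < 1" "z0 / 2 \<noteq> 0"
      using nz0 assms \<open>z0 \<noteq> 0\<close> by (auto simp: norm_divide)
    have "norm (K z0 - K (z0 / 2)) \<le> lam * (p / 2)"
      using dK[of z0 "z0 / 2"] nz0 half assms by (simp add: norm_divide)
    hence "norm (K (z0 / 2)) \<ge> lam * norm (z0 / 2)"
      using nKz0 nz0 norm_triangle_ineq2[of "K z0" "K (z0 / 2)"]
      by (simp add: norm_divide field_simps)
    moreover have "norm (K (z0 / 2)) \<le> lam * norm (z0 / 2)"
      using half by (intro nK) simp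
    ultimately have eq: "norm (k (z0 / 2) / of_real lam) = norm (z0 / 2)"
      using K(2)[of "z0 / 2"] half assms by (simp add: norm_divide field_simps)
    have "\<exists>\<alpha>. (\<forall>z. norm z < 1 \<longrightarrow> k z / of_real lam = \<alpha> * z) \<and> norm \<alpha> = 1"
    proof (rule Schwarz_Lemma(3)[of "\<lambda>z. k z / of_real lam" 0])
      fix z :: complex assume z: "norm z < 1"
      have "norm (k z) \<le> lam * norm z" using nK[of z] K(2)[of z] z by simp
      also have "\<dots> < lam" using z assms by simp
      finally show "norm (k z / of_real lam) < 1" using assms by (simp add: norm_divide)
    next
      show "(\<exists>z. norm z < 1 \<and> z \<noteq> 0 \<and> norm (k z / of_real lam) = norm z) \<or>
          norm (deriv (\<lambda>z. k z / of_real lam) 0) = 1"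
        using half eq by blast
    qed (use assms hol k0 in \<open>auto intro!: holomorphic_intros\<close>)
    thus ?thesis using that by blast
  qed
  \<comment> \<open>The identity \<open>K z = lam * \<alpha> * z\<close> extends by continuity to \<open>z0\<close>, which is on the unit circle
      when \<open>p = 1\<close>.\<close>
  have "K z0 - of_real lam * \<alpha> * z0 = 0"
  proof (rule continuous_constant_on_closure[of "ball 0 1" "\<lambda>z. K z - of_real lam * \<alpha> * z" 0])
    show "continuous_on (closure (ball 0 1)) (\<lambda>z. K z - of_real lam * \<alpha> * z)"
      using contK by (auto intro!: continuous_intros)
    show "K x - of_real lam * \<alpha> * x = 0" if "x \<in> ball 0 1" for x
      using \<alpha>[of x] K(2)[OF that] that assms by (simp add: field_simps)
  qed (use nz0 assms in auto)
  hence "of_real lam * (\<alpha> * z0\<^sup>2) = of_real lam * (of_real p)\<^sup>2"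
    using w by (simp add: power2_eq_square algebra_simps)
  hence "\<alpha> * z0\<^sup>2 = (of_real p)\<^sup>2" using assms by simp
  hence \<alpha>_eq: "\<alpha> = (of_real p / z0)\<^sup>2"
    using \<open>z0 \<noteq> 0\<close> by (simp add: field_simps)
  show ?thesis
  proof (rule that[of "of_real p / z0"])
    show "norm (of_real p / z0) = 1" using nz0 assms by (simp add: norm_divide)
    show "b = of_real p / z0 * of_real ((1 + lam * p\<^sup>2) / p)"
    proof -
      have "b * z0 = of_real (1 + lam * p\<^sup>2)" using fix_eq w by simp
      hence "b = of_real (1 + lam * p\<^sup>2) / z0" using \<open>z0 \<noteq> 0\<close> by (simp add: field_simps)
      thus ?thesis using \<open>0 < p\<close> by simp
    qed
    show "k z = of_real lam * (of_real p / z0)\<^sup>2 * z" if "z \<in> ball 0 1" for z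
      using \<alpha>[of z] that assms by (simp add: \<alpha>_eq field_simps)
  qed
qed

section \<open>The quotient of the identity by a normalized meromorphic function\<close>

text \<open>
  Comparing the coefficients of \<open>z\<^sup>2\<close> in \<open>g f = z\<close> gives \<open>a\<^sub>2 + g'(0) = 0\<close>.
\<close>
lemma taylor_coeff_2_of_reciprocal:
  assumes f: "f analytic_on {0}" "f 0 = 0" "deriv f 0 = 1"
    and g: "g analytic_on {0}" "g 0 = 1"
    and fg: "eventually (\<lambda>z. g z * f z = z) (nhds 0)"
  shows "taylor_coeff f 2 = - deriv g 0"
proof -
  define F G where "F = fps_expansion f 0" and "G = fps_expansion g 0"
  have "(\<lambda>z. g z * f z) has_fps_expansion G * F"
    unfolding F_def G_def
    by (intro has_fps_expansion_mult analytic_at_imp_has_fps_expansion_0 f g)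
  hence "(\<lambda>z. z) has_fps_expansion G * F"
    using fg by (simp cong: has_fps_expansion_cong)
  hence "G * F = fps_X"
    using fps_expansion_unique_complex has_fps_expansion_fps_X by blast
  hence "fps_nth (G * F) 2 = 0" by simp
  moreover have "fps_nth F 0 = 0" "fps_nth F 1 = 1" "fps_nth G 0 = 1" "fps_nth G 1 = deriv g 0"
    using f g by (simp_all add: F_def G_def fps_expansion_def)
  ultimately show ?thesis
    by (simp add: fps_mult_nth numeral_2_eq_2 taylor_coeff_def F_def[symmetric] eq_neg_iff_add_eq_0 add.commute)
qed

text \<open>
  The only obstruction would be zeros of \<open>f\<close> accumulating at \<open>z\<close>; then \<open>f\<close> would vanish identically,
  against \<open>f'(0) = 1\<close>.
\<close>
lemma z_over_mult_eventually:
  assumes f: "f \<in> U_class lam" and z: "z \<in> ball 0 1"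
  shows "eventually (\<lambda>w. z_over f w * f w = w) (at z)"
proof -
  from f have nm: "f nicely_meromorphic_on ball 0 1" and d: "(f has_field_derivative 1) (at 0)"
    by (auto simp: U_class_def)
  have "\<not> (\<forall>x\<in>ball 0 1. f x = 0)"
  proof
    assume *: "\<forall>x\<in>ball 0 1. f x = 0"
    have "((\<lambda>_. 0) has_field_derivative 1) (at (0::complex))"
      by (rule DERIV_cong_ev[THEN iffD1, OF refl _ refl d])
        (use * in \<open>auto intro!: eventually_nhds_in_open[of "ball 0 1", THEN eventually_mono]\<close>)
    thus False using DERIV_const DERIV_unique zero_neq_one by blast
  qed
  with nicely_meromorphic_imp_constant_or_avoid[OF nm, of 0]
  have "\<forall>\<^sub>\<approx>x\<in>ball 0 1. f x \<noteq> 0" by auto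
  hence "eventually (\<lambda>w. f w \<noteq> 0) (at z)"
    using z by (auto simp: eventually_cosparse_open_eq)
  moreover have "eventually (\<lambda>w. z_over f w = w / f w) (at z)"
  proof -
    have "f meromorphic_on {z}"
      using nm z by (auto simp: nicely_meromorphic_on_def intro: meromorphic_on_subset)
    hence "(\<lambda>w. w / f w) meromorphic_on {z}"
      by (intro meromorphic_intros)
    thus ?thesis unfolding z_over_def
      by (intro eventually_remove_sings_eq_at) (auto intro: meromorphic_on_isolated_singularity)
  qed
  ultimately show ?thesis by eventually_elim simp
qed

lemma U_class_analytic_0:
  assumes "f \<in> U_class lam"
  shows "f analytic_on {0}"
proof (rule nicely_meromorphic_on_imp_analytic_at[of _ "ball 0 1"])
  show "f nicely_meromorphic_on ball 0 1" using assms by (simp add: U_class_def)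
  have "isCont f 0" using assms by (auto simp: U_class_def intro: DERIV_isCont)
  thus "\<not> is_pole f 0"
    by (metis at_neq_bot isCont_def is_pole_def not_tendsto_and_filterlim_at_infinity)
qed simp

lemma z_over_0:
  assumes f: "f \<in> U_class lam"
  shows "z_over f 0 = 1"
proof -
  have "((\<lambda>h. (f (0 + h) - f 0) / h) \<longlongrightarrow> 1) (at 0)"
    using f by (auto simp: U_class_def DERIV_def)
  hence "((\<lambda>h. inverse (f h / h)) \<longlongrightarrow> inverse 1) (at 0)"
    using f by (intro tendsto_inverse) (auto simp: U_class_def)
  thus ?thesis unfolding z_over_def by (intro remove_sings_eqI) simp
qed

text \<open>
  Both factors are continuous at a point that is not a pole of \<open>f\<close>, so the identity passes from the
  punctured neighbourhood to the point. Away from the origin,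
  \<open>z_over f\<close> can therefore vanish only at poles of \<open>f\<close>.
\<close>
lemma z_over_mult:
  assumes f: "f \<in> U_class lam" and z: "z \<in> ball 0 1" and np: "\<not> is_pole f z"
  shows "z_over f z * f z = z"
proof -
  have "f analytic_on {z}"
    using f z np by (intro nicely_meromorphic_on_imp_analytic_at[of _ "ball 0 1"])
      (auto simp: U_class_def)
  hence "f \<midarrow>z\<rightarrow> f z" using analytic_at_imp_isCont isContD by blast
  moreover have "z_over f \<midarrow>z\<rightarrow> z_over f z"
    using f z by (metis (no_types, lifting) U_class_def mem_Collect_eq continuous_on_eq_continuous_at
        holomorphic_on_imp_continuous_on isContD open_ball)
  ultimately have "(\<lambda>w. z_over f w * f w) \<midarrow>z\<rightarrow> z_over f z * f z"
    by (intro tendsto_mult)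
  hence "(\<lambda>w. w) \<midarrow>z\<rightarrow> z_over f z * f z"
    using tendsto_cong[OF z_over_mult_eventually[OF f z]] by blast
  thus ?thesis by (metis LIM_unique tendsto_ident_at)
qed

text \<open>
  At a pole of \<open>f\<close> both sides are \<open>0\<close>: the left one because \<open>f\<close> is nicely meromorphic, the right one
  because \<open>z_over f\<close> vanishes there and division by zero gives zero.
\<close>
lemma eq_divide_z_over:
  assumes f: "f \<in> U_class lam" and z: "z \<in> ball 0 1"
  shows "f z = z / z_over f z"
proof (cases "is_pole f z")
  case False
  show ?thesis
  proof (cases "z = 0")
    case True
    thus ?thesis using f by (simp add: U_class_def)
  next
    case z0: False
    have "z_over f z \<noteq> 0" using z0 z_over_mult[OF f z False] by auto
    thus ?thesis using z_over_mult[OF f z False] by (simp add: field_simps)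
  qed
next
  case True
  have nm: "f nicely_meromorphic_on ball 0 1" using f by (simp add: U_class_def)
  have "f z = 0"
    using nm z True at_neq_bot not_tendsto_and_filterlim_at_infinity
    unfolding nicely_meromorphic_on_def is_pole_def by blast
  moreover have "z_over f z = 0"
  proof -
    have "((\<lambda>w. w / f w) \<longlongrightarrow> 0) (at z)"
      using True unfolding is_pole_def by (intro tendsto_divide_0[OF tendsto_ident_at])
    thus ?thesis unfolding z_over_def by (rule remove_sings_eqI)
  qed
  ultimately show ?thesis by simp
qed

lemma taylor_coeff_2_eq_minus_deriv_z_over:
  assumes f: "f \<in> U_class lam"
  shows "taylor_coeff f 2 = - deriv (z_over f) 0"
proof (rule taylor_coeff_2_of_reciprocal)
  show "f analytic_on {0}" using f by (rule U_class_analytic_0)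
  show "z_over f analytic_on {0}"
    using f by (auto simp: U_class_def analytic_at intro!: exI[of _ "ball 0 1"])
  show "eventually (\<lambda>z. z_over f z * f z = z) (nhds 0)"
    using z_over_mult_eventually[OF f, of 0] f by (auto simp: eventually_nhds_conv_at U_class_def)
qed (use f z_over_0[OF f] in \<open>auto simp: U_class_def DERIV_imp_deriv\<close>)

section \<open>Extremal functions\<close>

definition extremal_denom :: "real \<Rightarrow> real \<Rightarrow> complex \<Rightarrow> complex \<Rightarrow> complex" where
  "extremal_denom lam p u z = (1 - u * z / of_real p) * (1 - of_real lam * of_real p * u * z)"

lemma extremal_denom_expand:
  assumes "p \<noteq> 0"
  shows "extremal_denom lam p u z =
    1 - u * of_real ((1 + lam * p\<^sup>2) / p) * z + of_real lam * u\<^sup>2 * z\<^sup>2"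
proof -
  \<comment> \<open>Writing \<open>c\<close> for \<open>1/p\<close> leaves a polynomial identity modulo the single relation \<open>c * P = 1\<close>.\<close>
  have expand: "(1 - u * z * c) * (1 - l * P * u * z) = 1 - u * (c + l * P) * z + l * u\<^sup>2 * z\<^sup>2"
    if "c * P = 1" for c l P :: complex
  proof -
    have "(1 - u * z * c) * (1 - l * P * u * z) =
        1 - u * (c + l * P) * z + l * u\<^sup>2 * z\<^sup>2 * (c * P)"
      by (simp add: algebra_simps power2_eq_square)
    thus ?thesis using that by simp
  qed
  have "(1 + lam * p\<^sup>2) / p = 1 / p + lam * p"
    using assms by (simp add: field_simps power2_eq_square)
  hence coeff: "complex_of_real ((1 + lam * p\<^sup>2) / p) = 1 / of_real p + of_real lam * of_real p"
    by simp
  show ?thesis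
    unfolding coeff extremal_denom_def
    using expand[of "1 / of_real p" "of_real p" "of_real lam"] assms by simp
qed

lemma DERIV_extremal_denom:
  assumes "p \<noteq> 0"
  shows "(extremal_denom lam p u has_field_derivative
      - u * of_real ((1 + lam * p\<^sup>2) / p) + 2 * of_real lam * u\<^sup>2 * z) (at z)"
proof -
  have "((\<lambda>z. 1 - c * z + d * z\<^sup>2) has_field_derivative - c + 2 * d * z) (at z)" for c d :: complex
    by (auto intro!: derivative_eq_intros)
  from this[of "u * of_real ((1 + lam * p\<^sup>2) / p)" "of_real lam * u\<^sup>2"] show ?thesis
    by (simp add: extremal_denom_expand[OF assms, abs_def] mult.assoc)
qed

text \<open>
  The bound and its equality case come from one argument: a coefficient at least as large as the bound
  forces \<open>f\<close> to be an extremal function, whose coefficient equals the bound.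
\<close>
lemma large_coefficient_imp_extremal:
  assumes "0 < lam" "0 < p" "p \<le> 1"
    and f: "f \<in> U_class_no_pole lam p"
    and large: "(1 + lam * p\<^sup>2) / p \<le> norm (taylor_coeff f 2)"
  obtains u where "norm u = 1" "taylor_coeff f 2 = u * of_real ((1 + lam * p\<^sup>2) / p)"
    "\<And>z. z \<in> ball 0 1 \<Longrightarrow> f z = z / ((1 - u * z / of_real p) * (1 - of_real lam * of_real p * u * z))"
proof -
  have fU: "f \<in> U_class lam" and np: "\<And>z. norm z < p \<Longrightarrow> \<not> is_pole f z"
    using f by (auto simp: U_class_no_pole_def)
  define g where "g = z_over f"
  define b where "b = taylor_coeff f 2"
  have b: "deriv g 0 = - b" using taylor_coeff_2_eq_minus_deriv_z_over[OF fU] by (simp add: g_def b_def)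
  have g: "g holomorphic_on ball 0 1" "g 0 = 1"
    "\<And>z. z \<in> ball 0 1 \<Longrightarrow> norm (g z - z * deriv g z - 1) < lam"
    using fU z_over_0[OF fU] by (simp_all add: g_def U_class_def)
  obtain k where k: "k holomorphic_on ball 0 1" "k 0 = 0" "lam-lipschitz_on (ball 0 1) k"
    "\<And>z. z \<in> ball 0 1 \<Longrightarrow> g z = 1 + deriv g 0 * z + z * k z"
    using lipschitz_second_order_remainder[OF g] by blast
  have zero_free: "1 - b * z + z * k z \<noteq> 0" if "norm z < p" for z
  proof -
    have z: "z \<in> ball 0 1" using that assms by simp
    have "g z \<noteq> 0"
      using z_over_mult[OF fU z np[OF that]] z_over_0[OF fU]
      by (cases "z = 0") (auto simp: g_def)
    thus ?thesis using k(4)[OF z] b by simp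
  qed
  obtain u where u: "norm u = 1" "b = u * of_real ((1 + lam * p\<^sup>2) / p)"
    "\<And>z. z \<in> ball 0 1 \<Longrightarrow> k z = of_real lam * u\<^sup>2 * z"
    using zero_free_imp_extremal[OF assms(1-3) k(1-3) zero_free large[folded b_def]] by blast
  show ?thesis
  proof (rule that[of u])
    fix z :: complex assume z: "z \<in> ball 0 1"
    have "g z = (1 - u * z / of_real p) * (1 - of_real lam * of_real p * u * z)"
    proof -
      have "g z = 1 - b * z + of_real lam * u\<^sup>2 * z\<^sup>2"
        using k(4)[OF z] u(3)[OF z] b by (simp add: power2_eq_square mult_ac)
      also have "\<dots> = extremal_denom lam p u z"
        unfolding u(2) using assms by (intro extremal_denom_expand[symmetric]) simp
      finally show ?thesis by (simp add: extremal_denom_def)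
    qed
    thus "f z = z / ((1 - u * z / of_real p) * (1 - of_real lam * of_real p * u * z))"
      using eq_divide_z_over[OF fU z] by (simp add: g_def)
  next
    show "norm u = 1" by (rule u(1))
  next
    show "taylor_coeff f 2 = u * of_real ((1 + lam * p\<^sup>2) / p)"
      using u(2) unfolding b_def .
  qed
qed

lemma norm_taylor_coeff_2_extremal:
  assumes "0 < lam" "0 < p" and u: "norm u = 1"
    and fU: "f \<in> U_class lam'"
    and eq: "\<And>z. z \<in> ball 0 1 \<Longrightarrow> f z = z / extremal_denom lam p u z"
  shows "norm (taylor_coeff f 2) = (1 + lam * p\<^sup>2) / p"
proof -
  let ?q = "extremal_denom lam p u"
  have f: "f analytic_on {0}" "f 0 = 0" "deriv f 0 = 1"
    using fU U_class_analytic_0[OF fU] by (auto simp: U_class_def DERIV_imp_deriv)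
  have q: "?q holomorphic_on UNIV"
    unfolding extremal_denom_def by (intro holomorphic_intros) (use assms in auto)
  hence qan: "?q analytic_on {0}" using holomorphic_on_imp_analytic_at by blast
  have q0: "?q 0 = 1" by (simp add: extremal_denom_def)
  have "eventually (\<lambda>z. ?q z \<noteq> 0) (nhds 0)"
    using analytic_at_imp_isCont[OF qan] q0
    by (metis isCont_def tendsto_imp_eventually_ne tendsto_at_iff_tendsto_nhds zero_neq_one)
  moreover have "eventually (\<lambda>z::complex. z \<in> ball 0 1) (nhds 0)"
    by (intro eventually_nhds_in_open) auto
  ultimately have "eventually (\<lambda>z. ?q z * f z = z) (nhds 0)"
    by eventually_elim (use eq in auto)
  hence "taylor_coeff f 2 = - deriv ?q 0"
    using f qan q0 by (intro taylor_coeff_2_of_reciprocal)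
  also have "deriv ?q 0 = - u * of_real ((1 + lam * p\<^sup>2) / p)"
    using DERIV_imp_deriv[OF DERIV_extremal_denom[of p lam u 0]] assms by simp
  finally have "taylor_coeff f 2 = u * of_real ((1 + lam * p\<^sup>2) / p)" by simp
  hence "norm (taylor_coeff f 2) = \<bar>(1 + lam * p\<^sup>2) / p\<bar>"
    using u by (simp only: norm_mult norm_of_real)
  thus ?thesis using assms by simp
qed

text \<open>
  For the quadratic polynomial \<open>q(z) = 1 - bz + cz\<^sup>2\<close> one has \<open>q - z q' - 1 = -cz\<^sup>2\<close>; here
  \<open>|c| = lam\<close>, which gives the strict inequality in the disk. The roots of \<open>q\<close> have moduli \<open>p\<close> and
  \<open>1 / (lam * p) \<ge> 1\<close>, so \<open>z/q(z)\<close> has no pole in \<open>|z| < p\<close>.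
\<close>
lemma extremal_in_U_class_no_pole:
  assumes "0 < lam" "lam \<le> 1" "0 < p" "p \<le> 1" and u: "norm u = 1"
  shows "(\<lambda>z. z / extremal_denom lam p u z) \<in> U_class_no_pole lam p"
proof -
  let ?q = "extremal_denom lam p u" and ?f = "\<lambda>z. z / extremal_denom lam p u z"
  have q: "?q analytic_on A" for A
    unfolding extremal_denom_def by (intro analytic_intros) (use assms in auto)
  have q0: "?q 0 = 1" by (simp add: extremal_denom_def)
  have zeros: "z = of_real p / u \<or> z = 1 / (of_real lam * of_real p * u)" if "?q z = 0" for z
  proof -
    have "u \<noteq> 0" using u by auto
    consider "1 - u * z / of_real p = 0" | "1 - of_real lam * of_real p * u * z = 0"
      using \<open>?q z = 0\<close> unfolding extremal_denom_def mult_eq_0_iff by blast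
    thus ?thesis
    proof cases
      case 1
      hence "z = of_real p / u" using \<open>u \<noteq> 0\<close> assms by (simp add: field_simps)
      thus ?thesis ..
    next
      case 2
      hence "z = 1 / (of_real lam * of_real p * u)"
        using \<open>u \<noteq> 0\<close> assms by (simp add: field_simps)
      thus ?thesis ..
    qed
  qed
  have an: "?f analytic_on {z}" if "?q z \<noteq> 0" for z
    using q that by (intro analytic_intros) auto
  have qev: "eventually (\<lambda>w. ?q w \<noteq> 0) (at z)" for z
  proof -
    have "finite {w. ?q w = 0}"
      by (rule finite_subset[of _ "{of_real p / u, 1 / (of_real lam * of_real p * u)}"])
        (use zeros in auto)
    hence "open (- ({w. ?q w = 0} - {z}))"
      by (intro open_Compl finite_imp_closed) simp
    hence "eventually (\<lambda>w. w \<in> - ({w. ?q w = 0} - {z})) (nhds z)"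
      by (rule eventually_nhds_in_open) simp
    thus ?thesis by (auto simp: eventually_at_filter elim: eventually_mono)
  qed
  have pole: "is_pole ?f z" if "?q z = 0" for z
  proof -
    have "z \<noteq> 0" using that q0 by auto
    moreover have "filterlim ?q (at 0) (at z)"
      using analytic_at_imp_isCont[OF q] that qev by (metis filterlim_atI isCont_def)
    ultimately show ?thesis unfolding is_pole_def
      using filterlim_divide_at_infinity tendsto_ident_at by blast
  qed
  have nm: "?f nicely_meromorphic_on ball 0 1"
    unfolding nicely_meromorphic_on_def
  proof (intro conjI ballI)
    show "?f meromorphic_on ball 0 1"
      by (intro meromorphic_intros analytic_on_imp_meromorphic_on q)
    show "is_pole ?f z \<and> ?f z = 0 \<or> ?f \<midarrow>z\<rightarrow> ?f z" for z
      using pole[of z] an[of z] analytic_at_imp_isCont isContD by (cases "?q z = 0") auto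
  qed
  have zo: "z_over ?f = ?q"
  proof
    fix z
    have "?q \<midarrow>z\<rightarrow> ?q z" using analytic_at_imp_isCont[OF q] isContD by blast
    moreover have "eventually (\<lambda>w. w / ?f w = ?q w) (at z)"
      using qev[of z] eventually_neq_at_within[of 0 z UNIV]
      by eventually_elim (auto simp: field_simps)
    ultimately have "(\<lambda>w. w / ?f w) \<midarrow>z\<rightarrow> ?q z" by (simp cong: tendsto_cong)
    thus "z_over ?f z = ?q z" unfolding z_over_def by (rule remove_sings_eqI)
  qed
  have d: "(?f has_field_derivative 1) (at 0)"
    using q0 assms by (auto intro!: derivative_eq_intros DERIV_extremal_denom)
  have "norm (?q z - z * deriv ?q z - 1) < lam" if "z \<in> ball 0 1" for z
  proof -
    have "deriv ?q z = - u * of_real ((1 + lam * p\<^sup>2) / p) + 2 * of_real lam * u\<^sup>2 * z"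
      using DERIV_imp_deriv[OF DERIV_extremal_denom[of p]] assms by simp
    moreover have "?q z = 1 - u * of_real ((1 + lam * p\<^sup>2) / p) * z + of_real lam * u\<^sup>2 * z\<^sup>2"
      using assms by (intro extremal_denom_expand) simp
    moreover have "1 - u * c * z + d * z\<^sup>2 - z * (- u * c + 2 * d * z) - 1 = - d * z\<^sup>2" for c d
      by (simp add: algebra_simps power2_eq_square)
    ultimately have "?q z - z * deriv ?q z - 1 = - (of_real lam * u\<^sup>2) * z\<^sup>2"
      by (metis mult.assoc)
    hence "norm (?q z - z * deriv ?q z - 1) = lam * (norm z)\<^sup>2"
      using assms by (simp add: norm_mult norm_power)
    also have "\<dots> < lam"
      using that assms by (simp add: power_less_one_iff abs_square_less_1)
    finally show ?thesis .
  qed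
  hence "?f \<in> U_class lam"
    using nm d zo q by (simp add: U_class_def analytic_imp_holomorphic)
  moreover have "\<not> is_pole ?f z" if "z \<in> ball 0 p" for z
  proof -
    have "lam * p \<le> 1" using assms by (simp add: mult_le_one)
    hence "1 / (lam * p) \<ge> 1" using assms by (simp add: field_simps)
    moreover have "norm (of_real p / u) = p" "norm (1 / (of_real lam * of_real p * u)) = 1 / (lam * p)"
      using u assms by (simp_all add: norm_divide norm_mult)
    ultimately have "?q z \<noteq> 0"
      using zeros[of z] that \<open>p \<le> 1\<close> by force
    thus ?thesis using an[of z] analytic_at_imp_no_pole by blast
  qed
  ultimately show ?thesis by (simp add: U_class_no_pole_def)
qed

section \<open>The sharp bound for the second coefficient\<close>

theorem theorem3:
  fixes lam p :: real
  assumes "0 < lam" "lam \<le> 1" "0 < p" "p \<le> 1"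
  shows "(\<forall>f \<in> U_class_no_pole lam p. norm (taylor_coeff f 2) \<le> (1 + lam * p\<^sup>2) / p) \<and>
    (\<exists>f \<in> U_class_no_pole lam p. norm (taylor_coeff f 2) = (1 + lam * p\<^sup>2) / p) \<and>
    (\<forall>f \<in> U_class_no_pole lam p. norm (taylor_coeff f 2) = (1 + lam * p\<^sup>2) / p \<longleftrightarrow>
      (\<exists>\<theta>\<in>{0..<2*pi}. \<forall>z\<in>ball 0 1. f z =
        z / ((1 - exp (\<i> * of_real \<theta>) * z / of_real p) *
             (1 - of_real lam * of_real p * exp (\<i> * of_real \<theta>) * z))))"
proof -
  have pos: "0 < (1 + lam * p\<^sup>2) / p"
    using assms by (simp add: add_pos_nonneg)
  have bound: "norm (taylor_coeff f 2) \<le> (1 + lam * p\<^sup>2) / p"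
    if f: "f \<in> U_class_no_pole lam p" for f
  proof (rule ccontr)
    assume less: "\<not> ?thesis"
    hence large: "(1 + lam * p\<^sup>2) / p \<le> norm (taylor_coeff f 2)" by linarith
    obtain u where "norm u = 1" "taylor_coeff f 2 = u * of_real ((1 + lam * p\<^sup>2) / p)"
      using large_coefficient_imp_extremal[OF assms(1,3,4) f large] by blast
    hence "norm (taylor_coeff f 2) = \<bar>(1 + lam * p\<^sup>2) / p\<bar>"
      by (simp only: norm_mult norm_of_real)
    with less pos show False by linarith
  qed
  have formula: "norm (taylor_coeff f 2) = (1 + lam * p\<^sup>2) / p"
    if f: "f \<in> U_class_no_pole lam p" and u: "norm u = 1"
      and eq: "\<And>z. z \<in> ball 0 1 \<Longrightarrow> f z = z / extremal_denom lam p u z" for f u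
  proof (rule norm_taylor_coeff_2_extremal[OF assms(1,3) u _ eq])
    show "f \<in> U_class lam" using f by (simp add: U_class_no_pole_def)
  qed
  have sharp: "\<exists>f \<in> U_class_no_pole lam p. norm (taylor_coeff f 2) = (1 + lam * p\<^sup>2) / p"
    using extremal_in_U_class_no_pole[OF assms norm_one]
      formula[OF extremal_in_U_class_no_pole[OF assms norm_one] norm_one] by blast
  have rigid: "\<exists>\<theta>\<in>{0..<2*pi}. \<forall>z\<in>ball 0 1. f z =
        z / ((1 - exp (\<i> * of_real \<theta>) * z / of_real p) *
             (1 - of_real lam * of_real p * exp (\<i> * of_real \<theta>) * z))"
    if f: "f \<in> U_class_no_pole lam p"
      and eq: "norm (taylor_coeff f 2) = (1 + lam * p\<^sup>2) / p" for f
  proof -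
    obtain u where u: "norm u = 1"
      "\<And>z. z \<in> ball 0 1 \<Longrightarrow> f z = z / ((1 - u * z / of_real p) * (1 - of_real lam * of_real p * u * z))"
      using large_coefficient_imp_extremal[OF assms(1,3,4) f eq_refl[OF eq[symmetric]]] by blast
    have "u = exp (\<i> * of_real (Arg2pi u))"
      using Arg2pi_eq[of u] u(1) by simp
    moreover have "Arg2pi u \<in> {0..<2*pi}" by (simp add: Arg2pi_ge_0 Arg2pi_lt_2pi)
    ultimately show ?thesis using u(2) by metis
  qed
  have attained: "norm (taylor_coeff f 2) = (1 + lam * p\<^sup>2) / p"
    if "f \<in> U_class_no_pole lam p"
      and "\<exists>\<theta>\<in>{0..<2*pi}. \<forall>z\<in>ball 0 1. f z =
        z / ((1 - exp (\<i> * of_real \<theta>) * z / of_real p) *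
             (1 - of_real lam * of_real p * exp (\<i> * of_real \<theta>) * z))" for f
  proof -
    from that(2) obtain \<theta> :: real where
      "\<And>z. z \<in> ball 0 1 \<Longrightarrow> f z = z / extremal_denom lam p (exp (\<i> * of_real \<theta>)) z"
      unfolding extremal_denom_def by blast
    thus ?thesis by (rule formula[OF that(1) norm_exp_i_times])
  qed
  show ?thesis using bound sharp rigid attained by blast
qed

end
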